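(* Let $0<\alpha<1$, $1<p<\frac{1}{\alpha}$, and let $\theta_1,\theta_2$ be positive numbers such that $\theta_2<\theta_1(1+\alpha q)$, where $q=\frac{p}{1-\alpha p}$. Then the operator $I_\alpha$ is not bounded from $L^{p),\theta_1}([0,1])$ to $L^{q),\theta_2}([0,1])$; that is, there is no constant $c>0$ such that $\|I_\alpha f\|_{L^{q),\theta_2}([0,1])}\le c\,\|f\|_{L^{p),\theta_1}([0,1])}$ for all $f\in L^{p),\theta_1}([0,1])$.
   Context: $I_\alpha$ is the Riesz potential operator on $[0,1]$: $(I_\alpha f)(x)=\int_0^1\frac{f(y)}{|x-y|^{1-\alpha}}\,dy$, $x\in[0,1]$. For $1<r<\infty$ and $\theta>0$, the generalized grand Lebesgue space $L^{r),\theta}([0,1])$ is the class of measurable $f:[0,1]\to\mathbb{R}$ for which the norm $\|f\|_{L^{r),\theta}([0,1])}=\sup_{0<\varepsilon<r-1}\left(\varepsilon^{\theta}\int_0^1|f(t)|^{r-\varepsilon}\,dt\right)^{1/(r-\varepsilon)}$ is finite. *)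

theory Defs
  imports "HOL-Analysis.Analysis"
begin

(* Real powers of extended nonnegative reals.  Only used for positive exponents s,
   for which infinity to the power s is infinity and 0 to the power s is 0. *)
definition ennreal_powr :: "ennreal \<Rightarrow> real \<Rightarrow> ennreal" where
  "ennreal_powr x s = (if x = \<infinity> then \<infinity> else ennreal (enn2real x powr s))"

(* Extended-valued, so that it is infinite (rather than a junk real) outside the space. *)
definition grand_norm :: "real \<Rightarrow> real \<Rightarrow> (real \<Rightarrow> real) \<Rightarrow> ennreal" where
  "grand_norm r \<theta> f =
     (SUP \<epsilon>\<in>{0<..<r - 1}.
        ennreal_powr
          (ennreal (\<epsilon> powr \<theta>) * (\<integral>\<^sup>+ t. ennreal (\<bar>f t\<bar> powr (r - \<epsilon>)) \<partial>lebesgue_on {0..1}))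
          (1 / (r - \<epsilon>)))"

(* Functions on [0,1] are represented by functions on the reals whose values
   outside [0,1] are irrelevant. *)
definition grand_Lebesgue :: "real \<Rightarrow> real \<Rightarrow> (real \<Rightarrow> real) set" where
  "grand_Lebesgue r \<theta> =
     {f. f \<in> borel_measurable (lebesgue_on {0..1}) \<and> grand_norm r \<theta> f < \<infinity>}"

(* The Bochner integral is 0 at points x where the integral does not converge absolutely;
   for f integrable on [0,1] these x form a null set.  At the single point y = x the
   integrand is 0 by the conventions 0 powr a = 0 and a / 0 = 0. *)
definition riesz_potential :: "real \<Rightarrow> (real \<Rightarrow> real) \<Rightarrow> real \<Rightarrow> real" where
  "riesz_potential \<alpha> f x =
     (\<integral> y. f y / \<bar>x - y\<bar> powr (1 - \<alpha>) \<partial>lebesgue_on {0..1})"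

end

theory Submission
  imports Defs
begin

text \<open>
  Testing on indicator functions of short intervals $[0,\eta]$ is enough. Write $\eta = e^{-L}$. The
  integrand in the $L^{r),\theta}$-norm of such an indicator is explicit, and the norm is of size
  $\eta^{1/r} L^{-\theta/r}$: raising the exponent from $1/r$ to $1/(r-\varepsilon)$ costs a factor
  of about $e^{-\varepsilon L/r^2}$, while $\varepsilon^\theta$ favours large $\varepsilon$, and the
  two balance at $\varepsilon \approx 1/L$. The upper half of this estimate, for $r = p$, is
  \<open>grand_norm_indicator_upper\<close>.

  On $[0,\eta]$ the kernel is at least $\eta^{\alpha-1}$, so there the potential of the indicator
  is at least $\eta^\alpha$ (\<open>riesz_potential_indicator_ge\<close>). Taking $\varepsilon = 1/L$ in the
  target norm gives at least $\eta^{\alpha+1/q} L^{-\theta_2/q}$ up to a constant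
  (\<open>grand_norm_ge\<close>, \<open>grand_exponent_lower\<close>).

  Since $\alpha + 1/q = 1/p$, the powers of $\eta$ agree, and boundedness would force
  $L^{\theta_1/p - \theta_2/q}$ to stay bounded as $L \to \infty$. But $1 + \alpha q = q/p$, so the
  hypothesis on $\theta_1$ and $\theta_2$ says exactly that this exponent is positive.
\<close>

section \<open>Grand norms and indicators of short intervals\<close>

lemma ennreal_powr_ennreal:
  "0 \<le> x \<Longrightarrow> ennreal_powr (ennreal x) s = ennreal (x powr s)"
  by (simp add: ennreal_powr_def)

lemma ennreal_powr_mono:
  assumes "x \<le> y" "0 \<le> s"
  shows "ennreal_powr x s \<le> ennreal_powr y s"
proof (cases "y = \<infinity>")
  case False
  then have "x \<noteq> \<infinity>" "enn2real x \<le> enn2real y"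
    using assms by (auto simp: top.not_eq_extremum top_unique intro: enn2real_mono)
  with False assms show ?thesis
    by (auto simp: ennreal_powr_def intro!: ennreal_leI powr_mono2)
qed (simp add: ennreal_powr_def)

lemma nn_integral_scaled_indicator_initial:
  fixes \<eta> a :: real
  assumes "0 \<le> \<eta>" "\<eta> \<le> 1" "0 \<le> a"
  shows "(\<integral>\<^sup>+ t. ennreal (a * indicator {0..\<eta>} t) \<partial>lebesgue_on {0..1}) = ennreal (a * \<eta>)"
proof -
  have "(\<integral>\<^sup>+ t. ennreal (a * indicator {0..\<eta>} t) \<partial>lebesgue_on {0..1})
      = (\<integral>\<^sup>+ t. ennreal a * indicator {0..\<eta>} t \<partial>lebesgue_on {0..1})"
    by (intro nn_integral_cong) (auto simp: indicator_def)
  also have "\<dots> = ennreal a * emeasure (lebesgue_on {0..1}) {0..\<eta>}"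
    using assms by (intro nn_integral_cmult_indicator) (auto simp: sets_restrict_space_iff)
  also have "\<dots> = ennreal (a * \<eta>)"
    using assms by (simp add: emeasure_restrict_space ennreal_mult)
  finally show ?thesis .
qed

lemma powr_exp_eq_exp:
  fixes \<epsilon> :: real
  assumes "0 < \<epsilon>"
  shows "(\<epsilon> powr \<theta> * exp (- L)) powr s = exp ((\<theta> * ln \<epsilon> - L) * s)"
proof -
  have "\<epsilon> powr \<theta> * exp (- L) = exp (\<theta> * ln \<epsilon> - L)"
    using assms by (simp add: powr_def exp_diff exp_minus field_simps)
  then show ?thesis by (simp add: powr_def mult.commute)
qed

lemma grand_norm_indicator:
  assumes "0 \<le> L"
  shows "grand_norm r \<theta> (indicator {0..exp (- L)}) =
    (SUP \<epsilon>\<in>{0<..<r - 1}. ennreal (exp ((\<theta> * ln \<epsilon> - L) / (r - \<epsilon>))))"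
  unfolding grand_norm_def
proof (intro SUP_cong refl)
  fix \<epsilon> assume "\<epsilon> \<in> {0<..<r - 1}"
  then have e: "0 < \<epsilon>" "0 < r - \<epsilon>" by auto
  have "(\<integral>\<^sup>+ t. ennreal (\<bar>indicator {0..exp (- L)} t\<bar> powr (r - \<epsilon>)) \<partial>lebesgue_on {0..1})
      = (\<integral>\<^sup>+ t. ennreal (1 * indicator {0..exp (- L)} t) \<partial>lebesgue_on {0..1})"
    using e by (intro nn_integral_cong) (auto simp: indicator_def)
  also have "\<dots> = ennreal (exp (- L))"
    using assms nn_integral_scaled_indicator_initial[of "exp (- L)" 1] by simp
  finally show "ennreal_powr (ennreal (\<epsilon> powr \<theta>) *
        (\<integral>\<^sup>+ t. ennreal (\<bar>indicator {0..exp (- L)} t\<bar> powr (r - \<epsilon>)) \<partial>lebesgue_on {0..1}))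
        (1 / (r - \<epsilon>)) = ennreal (exp ((\<theta> * ln \<epsilon> - L) / (r - \<epsilon>)))"
    using e by (simp add: ennreal_powr_ennreal powr_exp_eq_exp flip: ennreal_mult)
qed

text \<open>
  A pointwise bound on $[0, e^{-L}]$ alone suffices, and every admissible $\varepsilon$ yields a
  lower bound: the factor $m^{r-\varepsilon}$ comes out of the root as $m$, which leaves the
  \<open>\<epsilon>\<close>-term of the norm of the indicator.
\<close>

lemma grand_norm_ge:
  fixes g :: "real \<Rightarrow> real"
  assumes "0 \<le> L" "0 < \<epsilon>" "\<epsilon> < r - 1" "0 < m"
    and g: "\<And>t. t \<in> {0..exp (- L)} \<Longrightarrow> m \<le> \<bar>g t\<bar>"
  shows "ennreal (m * exp ((\<theta> * ln \<epsilon> - L) / (r - \<epsilon>))) \<le> grand_norm r \<theta> g"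
proof -
  have r: "0 < r - \<epsilon>" using assms by simp
  have "ennreal (m powr (r - \<epsilon>) * exp (- L))
      = (\<integral>\<^sup>+ t. ennreal (m powr (r - \<epsilon>) * indicator {0..exp (- L)} t) \<partial>lebesgue_on {0..1})"
    using assms by (intro nn_integral_scaled_indicator_initial[symmetric]) auto
  also have "\<dots> \<le> (\<integral>\<^sup>+ t. ennreal (\<bar>g t\<bar> powr (r - \<epsilon>)) \<partial>lebesgue_on {0..1})"
    using assms r
    by (intro nn_integral_mono ennreal_leI) (auto simp: indicator_def intro!: powr_mono2)
  finally have I: "ennreal (m powr (r - \<epsilon>) * exp (- L))
      \<le> (\<integral>\<^sup>+ t. ennreal (\<bar>g t\<bar> powr (r - \<epsilon>)) \<partial>lebesgue_on {0..1})" .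
  have "m * exp ((\<theta> * ln \<epsilon> - L) / (r - \<epsilon>))
      = (m powr (r - \<epsilon>) * (\<epsilon> powr \<theta> * exp (- L))) powr (1 / (r - \<epsilon>))"
    using assms r by (simp add: powr_mult[of "m powr (r - \<epsilon>)"] powr_powr powr_exp_eq_exp)
  also have "\<dots> = (\<epsilon> powr \<theta> * (m powr (r - \<epsilon>) * exp (- L))) powr (1 / (r - \<epsilon>))"
    by (simp add: mult_ac)
  finally have "ennreal (m * exp ((\<theta> * ln \<epsilon> - L) / (r - \<epsilon>)))
      = ennreal_powr (ennreal (\<epsilon> powr \<theta>) * ennreal (m powr (r - \<epsilon>) * exp (- L))) (1 / (r - \<epsilon>))"
    by (simp add: ennreal_powr_ennreal flip: ennreal_mult)
  also have "\<dots> \<le> ennreal_powr (ennreal (\<epsilon> powr \<theta>) *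
      (\<integral>\<^sup>+ t. ennreal (\<bar>g t\<bar> powr (r - \<epsilon>)) \<partial>lebesgue_on {0..1})) (1 / (r - \<epsilon>))"
    using r by (intro ennreal_powr_mono mult_left_mono I) auto
  also have "\<dots> \<le> grand_norm r \<theta> g"
    unfolding grand_norm_def using assms by (intro SUP_upper) auto
  finally show ?thesis .
qed

section \<open>The size of the exponent\<close>

text \<open>
  With $x = \theta \ln\varepsilon - L$ this separates the main terms, which carry the factor $1/r$, from an error.
\<close>

lemma divide_exponent_split:
  fixes r \<epsilon> x :: real
  assumes "0 < r" "0 < r - \<epsilon>"
  shows "x / (r - \<epsilon>) = x / r + \<epsilon> * x / (r * (r - \<epsilon>))"
proof -
  define d where "d = r - \<epsilon>"
  have "0 < d" "r = \<epsilon> + d" using assms by (simp_all add: d_def)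
  with assms(1) show ?thesis
    unfolding d_def[symmetric] by (simp add: divide_simps) (simp add: algebra_simps)
qed

text \<open>
  The part of the error coming from $\varepsilon\ln\varepsilon$ is bounded above; the part
  $-\varepsilon L/r^2$ is kept, since it pays for $(\theta/r)\ln(\varepsilon L)$ by the tangent
  line of the logarithm at $\varepsilon L = \theta r$.
\<close>

lemma grand_exponent_upper:
  fixes r \<theta> \<epsilon> L :: real
  assumes "0 < \<theta>" "1 \<le> L" "0 < \<epsilon>" "\<epsilon> < r - 1"
  shows "(\<theta> * ln \<epsilon> - L) / (r - \<epsilon>)
    \<le> \<theta> * r\<^sup>2 + \<theta> / r * ln (\<theta> * r) - L / r - \<theta> / r * ln L"
proof -
  have r: "1 < r" "1 < r - \<epsilon>" using assms by auto
  have D: "1 \<le> r * (r - \<epsilon>)" "r * (r - \<epsilon>) \<le> r\<^sup>2"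
    using r assms mult_mono[of 1 r 1 "r - \<epsilon>"] mult_left_mono[of "r - \<epsilon>" r r]
    by (auto simp: power2_eq_square)
  have split: "(\<theta> * ln \<epsilon> - L) / (r - \<epsilon>) =
     (\<theta> * ln \<epsilon> - L) / r + \<theta> * (\<epsilon> * ln \<epsilon> / (r * (r - \<epsilon>))) - \<epsilon> * L / (r * (r - \<epsilon>))"
    using r divide_exponent_split[of r \<epsilon> "\<theta> * ln \<epsilon> - L"]
    by (simp add: right_diff_distrib diff_divide_distrib mult.left_commute)
  have e1: "\<epsilon> * ln \<epsilon> / (r * (r - \<epsilon>)) \<le> r\<^sup>2"
  proof (cases "\<epsilon> \<le> 1")
    case True
    then have "\<epsilon> * ln \<epsilon> \<le> 0" using assms by (intro mult_nonneg_nonpos) auto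
    then have "\<epsilon> * ln \<epsilon> / (r * (r - \<epsilon>)) \<le> 0"
      using D by (intro divide_nonpos_pos) auto
    then show ?thesis by (rule order_trans) simp
  next
    case False
    have "ln \<epsilon> \<le> r" using ln_le_minus_one[of \<epsilon>] assms by auto
    then have "\<epsilon> * ln \<epsilon> \<le> r * r" using False assms r by (intro mult_mono) auto
    also have "\<dots> \<le> r\<^sup>2 * (r * (r - \<epsilon>))"
      using mult_left_mono[OF D(1), of "r\<^sup>2"] by (simp add: power2_eq_square)
    finally show ?thesis using D by (simp add: pos_divide_le_eq)
  qed
  have e2: "\<epsilon> * L / r\<^sup>2 \<le> \<epsilon> * L / (r * (r - \<epsilon>))"
    using D assms by (intro divide_left_mono) auto
  have "ln (\<epsilon> * L / (\<theta> * r)) \<le> \<epsilon> * L / (\<theta> * r)"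
    using ln_le_minus_one[of "\<epsilon> * L / (\<theta> * r)"] assms r by simp
  then have "ln \<epsilon> + ln L - ln (\<theta> * r) \<le> \<epsilon> * L / (\<theta> * r)"
    using assms r by (simp add: ln_div ln_mult)
  then have "\<theta> / r * (ln \<epsilon> + ln L - ln (\<theta> * r)) \<le> \<theta> / r * (\<epsilon> * L / (\<theta> * r))"
    using assms r by (intro mult_left_mono) auto
  also have "\<dots> = \<epsilon> * L / r\<^sup>2" using assms by (simp add: power2_eq_square)
  finally have e3: "\<theta> / r * ln \<epsilon> + \<theta> / r * ln L - \<theta> / r * ln (\<theta> * r) \<le> \<epsilon> * L / r\<^sup>2"
    by (simp add: algebra_simps)
  have "\<theta> * (\<epsilon> * ln \<epsilon> / (r * (r - \<epsilon>))) \<le> \<theta> * r\<^sup>2"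
    using e1 assms by (intro mult_left_mono) auto
  moreover have "(\<theta> * ln \<epsilon> - L) / r = \<theta> / r * ln \<epsilon> - L / r"
    by (simp add: diff_divide_distrib)
  ultimately show ?thesis using split e2 e3 by linarith
qed

text \<open>
  At $\varepsilon = 1/L$ the error is bounded, since then $\varepsilon L = 1$ and
  $\varepsilon \ln L \le 1$; so this choice attains the main terms of the upper estimate.
\<close>

lemma grand_exponent_lower:
  fixes r \<theta> L :: real
  assumes "0 < \<theta>" "1 \<le> L" "1 / L < r - 1"
  shows "- L / r - \<theta> / r * ln L - (1 + \<theta>) \<le> (\<theta> * ln (1 / L) - L) / (r - 1 / L)"
proof -
  define \<epsilon> where "\<epsilon> = 1 / L"
  have e: "0 < \<epsilon>" "\<epsilon> * L = 1" using assms by (auto simp: \<epsilon>_def)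
  have r: "1 < r" "1 < r - \<epsilon>" using assms(3) e by (simp_all flip: \<epsilon>_def)
  have D: "1 \<le> r * (r - \<epsilon>)"
    using r mult_mono[of 1 r 1 "r - \<epsilon>"] by auto
  have split: "(\<theta> * ln (1 / L) - L) / (r - \<epsilon>) =
      - L / r - \<theta> / r * ln L - (\<epsilon> * L + \<theta> * (\<epsilon> * ln L)) / (r * (r - \<epsilon>))"
    using r assms by (simp add: ln_div field_simps)
  have "\<epsilon> * ln L \<le> \<epsilon> * L"
    using e assms ln_le_minus_one[of L] by (intro mult_left_mono) auto
  then have "\<theta> * (\<epsilon> * ln L) \<le> \<theta> * 1" using e assms by (intro mult_left_mono) auto
  then have "\<epsilon> * L + \<theta> * (\<epsilon> * ln L) \<le> (1 + \<theta>) * 1" using e by simp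
  also have "\<dots> \<le> (1 + \<theta>) * (r * (r - \<epsilon>))"
    using D assms by (intro mult_left_mono) auto
  finally have "(\<epsilon> * L + \<theta> * (\<epsilon> * ln L)) / (r * (r - \<epsilon>)) \<le> 1 + \<theta>"
    using D by (simp add: pos_divide_le_eq)
  then show ?thesis using split by (simp add: \<epsilon>_def)
qed

lemma grand_norm_indicator_upper:
  assumes "0 < \<theta>" "1 \<le> L"
  shows "grand_norm r \<theta> (indicator {0..exp (- L)}) \<le>
    ennreal (exp (\<theta> * r\<^sup>2 + \<theta> / r * ln (\<theta> * r) - L / r - \<theta> / r * ln L))"
proof -
  have "0 \<le> L" using assms by simp
  then show ?thesis
    unfolding grand_norm_indicator[OF \<open>0 \<le> L\<close>]
    using assms grand_exponent_upper by (intro SUP_least ennreal_leI) auto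
qed

lemma indicator_in_grand_Lebesgue:
  assumes "0 < \<theta>" "1 \<le> L"
  shows "indicator {0..exp (- L)} \<in> grand_Lebesgue r \<theta>"
proof -
  have "indicator {0..exp (- L)} \<in> borel_measurable (lebesgue_on {0..1::real})"
    by (intro measurable_restrict_space1 borel_measurable_indicator) auto
  moreover have "grand_norm r \<theta> (indicator {0..exp (- L)}) < \<infinity>"
    using grand_norm_indicator_upper[OF assms] by (rule le_less_trans) simp
  ultimately show ?thesis by (simp add: grand_Lebesgue_def)
qed

section \<open>The Riesz potential of an indicator\<close>

lemma riesz_kernel_eq_powr:
  fixes \<alpha> t :: real
  shows "1 / t powr (1 - \<alpha>) = t powr (\<alpha> - 1)"
  using powr_minus_divide[of t "1 - \<alpha>"] by simp

text \<open>
  Integrability of the kernel guards against the default value 0 of the Bochner integral, which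
  would make lower bounds on the potential false. It reduces to that of $t^{\alpha-1}$ on $[0,1]$
  by reflection at the singularity and translation.
\<close>

lemma riesz_kernel_integrable:
  fixes \<alpha> x :: real
  assumes "0 < \<alpha>" "0 \<le> x" "x \<le> 1"
  shows "integrable (lebesgue_on {0..1}) (\<lambda>y. 1 / \<bar>x - y\<bar> powr (1 - \<alpha>))"
proof -
  define k :: "real \<Rightarrow> real" where "k t = \<bar>t\<bar> powr (\<alpha> - 1)" for t
  have right: "k integrable_on {0..1}"
    using assms integrable_on_powr_from_0[of "\<alpha> - 1" 1]
    by (subst integrable_cong[where g = "\<lambda>t. t powr (\<alpha> - 1)"]) (auto simp: k_def)
  have "k integrable_on {-1..0}"
    using Henstock_Kurzweil_Integration.integrable_reflect_real[where f = k and a = "-1" and b = 0] right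
    unfolding k_def by simp
  then have "k integrable_on {-1..1}"
    using right by (intro Henstock_Kurzweil_Integration.integrable_combine[of "-1" 0 1]) auto
  then have "k integrable_on {- x..1 - x}"
    by (rule integrable_on_subinterval) (use assms in auto)
  then have "(\<lambda>y. k (y - x)) integrable_on {0..1}"
    using integrable_shift_real_ivl[of k "- x" "1 - x" "- x"] by simp
  then have "(\<lambda>y. 1 / \<bar>x - y\<bar> powr (1 - \<alpha>)) integrable_on {0..1}"
    by (rule integrable_eq) (simp add: k_def riesz_kernel_eq_powr abs_minus_commute)
  then have "(\<lambda>y. 1 / \<bar>x - y\<bar> powr (1 - \<alpha>)) absolutely_integrable_on {0..1}"
    by (intro nonnegative_absolutely_integrable_1) auto
  then show ?thesis
    by (rule absolutely_integrable_imp_integrable) simp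
qed

text \<open>
  Two points of $[0,\eta]$ are at distance at most $\eta$, so the integrand is at least
  $\eta^{\alpha-1}$ almost everywhere on an interval of length $\eta$.
\<close>

lemma riesz_potential_indicator_ge:
  assumes "0 < \<alpha>" "\<alpha> < 1" "0 < \<eta>" "\<eta> \<le> 1" "x \<in> {0..\<eta>}"
  shows "\<eta> powr \<alpha> \<le> riesz_potential \<alpha> (indicator {0..\<eta>}) x"
proof -
  define M where "M = lebesgue_on {0..1::real}"
  have S: "{0..\<eta>} \<in> sets M" using assms by (auto simp: M_def sets_restrict_space_iff)
  have "integrable M (\<lambda>y. indicat_real {0..\<eta>} y *\<^sub>R (1 / \<bar>x - y\<bar> powr (1 - \<alpha>)))"
    using riesz_kernel_integrable[of \<alpha> x] assms S
    by (intro integrable_mult_indicator) (auto simp: M_def)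
  then have int: "integrable M (\<lambda>y. indicat_real {0..\<eta>} y / \<bar>x - y\<bar> powr (1 - \<alpha>))" by simp
  have em: "emeasure M {0..\<eta>} = ennreal \<eta>"
    using assms by (simp add: M_def emeasure_restrict_space)
  have "\<eta> powr \<alpha> = \<eta> powr (\<alpha> - 1) * \<eta>"
    using assms by (simp add: powr_diff)
  also have "\<dots> = (\<integral>y. \<eta> powr (\<alpha> - 1) * indicat_real {0..\<eta>} y \<partial>M)"
    using assms em S by (simp add: measure_def)
  also have "\<dots> \<le> (\<integral>y. indicat_real {0..\<eta>} y / \<bar>x - y\<bar> powr (1 - \<alpha>) \<partial>M)"
  proof (rule integral_mono_AE)
    show "integrable M (\<lambda>y. \<eta> powr (\<alpha> - 1) * indicat_real {0..\<eta>} y)"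
      using S em by (intro integrable_mult_right integrable_real_indicator) auto
    \<comment> \<open>The bound fails at the single point \<open>y = x\<close>, where the kernel takes the value 0.\<close>
    have "AE y in M. y \<noteq> x"
      unfolding M_def by (intro AE_I'[of "{x}"]) (use assms in \<open>auto simp: null_sets_restrict_space\<close>)
    then show "AE y in M. \<eta> powr (\<alpha> - 1) * indicat_real {0..\<eta>} y
        \<le> indicat_real {0..\<eta>} y / \<bar>x - y\<bar> powr (1 - \<alpha>)"
    proof eventually_elim
      case (elim y)
      have "\<eta> powr (\<alpha> - 1) \<le> \<bar>x - y\<bar> powr (\<alpha> - 1)" if "y \<in> {0..\<eta>}"
        using assms elim that by (intro powr_mono2') auto
      then show ?case
        by (auto simp: indicator_def riesz_kernel_eq_powr)
    qed
  qed (rule int)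
  finally show ?thesis by (simp add: riesz_potential_def M_def)
qed

section \<open>Failure of boundedness\<close>

theorem theorem2p1:
  fixes \<alpha> p q \<theta>\<^sub>1 \<theta>\<^sub>2 :: real
  assumes "0 < \<alpha>" and "\<alpha> < 1"
    and "1 < p" and "p < 1 / \<alpha>"
    and "q = p / (1 - \<alpha> * p)"
    and "0 < \<theta>\<^sub>1" and "0 < \<theta>\<^sub>2"
    and "\<theta>\<^sub>2 < \<theta>\<^sub>1 * (1 + \<alpha> * q)"
  shows "\<not> (\<exists>c::real. c > 0 \<and>
           (\<forall>f \<in> grand_Lebesgue p \<theta>\<^sub>1.
              grand_norm q \<theta>\<^sub>2 (riesz_potential \<alpha> f) \<le> ennreal c * grand_norm p \<theta>\<^sub>1 f))"
proof
  assume "\<exists>c::real. c > 0 \<and>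
           (\<forall>f \<in> grand_Lebesgue p \<theta>\<^sub>1.
              grand_norm q \<theta>\<^sub>2 (riesz_potential \<alpha> f) \<le> ennreal c * grand_norm p \<theta>\<^sub>1 f)"
  then obtain c :: real where c: "0 < c"
    and bdd: "\<And>f. f \<in> grand_Lebesgue p \<theta>\<^sub>1 \<Longrightarrow>
      grand_norm q \<theta>\<^sub>2 (riesz_potential \<alpha> f) \<le> ennreal c * grand_norm p \<theta>\<^sub>1 f"
    by blast
  have ap: "0 < 1 - \<alpha> * p" "1 - \<alpha> * p < 1" using assms by (auto simp: field_simps)
  have q1: "1 < q"
    using assms(3) ap unfolding assms(5) by simp
  have inv_q: "1 / p = \<alpha> + 1 / q"
    using assms(3) ap unfolding assms(5) by (simp add: field_simps)
  then have "1 + \<alpha> * q = q / p" using q1 assms(3) by (simp add: field_simps)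
  then have "\<theta>\<^sub>2 < \<theta>\<^sub>1 * (q / p)" using assms(8) by simp
  then have \<delta>: "0 < \<theta>\<^sub>1 / p - \<theta>\<^sub>2 / q" using q1 assms(3) by (simp add: field_simps)
  define \<delta> where "\<delta> = \<theta>\<^sub>1 / p - \<theta>\<^sub>2 / q"
  define K where "K = \<theta>\<^sub>1 * p\<^sup>2 + \<theta>\<^sub>1 / p * ln (\<theta>\<^sub>1 * p)"
  define B where "B = ln c + K + 1 + \<theta>\<^sub>2"
  \<comment> \<open>\<open>ln L\<close> must exceed \<open>B / \<delta>\<close> for the contradiction; the other entry makes \<open>1 / L\<close> an
    admissible \<open>\<epsilon>\<close> in the target norm.\<close>
  define L where "L = exp (max (1 / (q - 1)) (B / \<delta> + 1))"
  have "1 / (q - 1) \<le> max (1 / (q - 1)) (B / \<delta> + 1)" by (rule max.cobounded1)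
  also have "\<dots> < L"
    using exp_ge_add_one_self[of "max (1 / (q - 1)) (B / \<delta> + 1)"] unfolding L_def by linarith
  finally have "1 / (q - 1) < L" .
  then have L2: "1 / L < q - 1" using q1 by (simp add: L_def field_simps)
  have L1: "1 \<le> L" using q1 by (simp add: L_def le_max_iff_disj)
  have "B / \<delta> < ln L" by (simp add: L_def)
  then have lnL: "B < \<delta> * ln L" using \<delta> by (simp add: \<delta>_def[symmetric] field_simps)
  define f where "f = indicat_real {0..exp (- L)}"
  have "ennreal (exp (- L) powr \<alpha> * exp ((\<theta>\<^sub>2 * ln (1 / L) - L) / (q - 1 / L)))
      \<le> grand_norm q \<theta>\<^sub>2 (riesz_potential \<alpha> f)"
  proof (rule grand_norm_ge)
    fix t assume "t \<in> {0..exp (- L)}"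
    then have "exp (- L) powr \<alpha> \<le> riesz_potential \<alpha> f t"
      unfolding f_def using assms L1 by (intro riesz_potential_indicator_ge) auto
    then show "exp (- L) powr \<alpha> \<le> \<bar>riesz_potential \<alpha> f t\<bar>" by linarith
  qed (use L1 L2 in auto)
  also have "\<dots> \<le> ennreal c * grand_norm p \<theta>\<^sub>1 f"
    using bdd indicator_in_grand_Lebesgue[of \<theta>\<^sub>1 L p] assms L1 by (simp add: f_def)
  also have "\<dots> \<le> ennreal c * ennreal (exp (K - L / p - \<theta>\<^sub>1 / p * ln L))"
    using grand_norm_indicator_upper[of \<theta>\<^sub>1 L p] assms L1
    by (intro mult_left_mono) (auto simp: f_def K_def)
  also have "\<dots> = ennreal (exp (ln c + (K - L / p - \<theta>\<^sub>1 / p * ln L)))"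
    using c by (simp add: exp_add flip: ennreal_mult)
  also have "exp (- L) powr \<alpha> * exp ((\<theta>\<^sub>2 * ln (1 / L) - L) / (q - 1 / L))
      = exp (- \<alpha> * L + (\<theta>\<^sub>2 * ln (1 / L) - L) / (q - 1 / L))"
    by (simp add: powr_def flip: exp_add)
  finally have "- \<alpha> * L + (\<theta>\<^sub>2 * ln (1 / L) - L) / (q - 1 / L)
      \<le> ln c + (K - L / p - \<theta>\<^sub>1 / p * ln L)"
    by simp
  moreover have "- L / q - \<theta>\<^sub>2 / q * ln L - (1 + \<theta>\<^sub>2)
      \<le> (\<theta>\<^sub>2 * ln (1 / L) - L) / (q - 1 / L)"
    using assms L1 L2 by (intro grand_exponent_lower) auto
  moreover have "L / p = \<alpha> * L + L / q"
    using arg_cong[OF inv_q, of "\<lambda>s. L * s"] by (simp add: algebra_simps)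
  moreover have "\<delta> * ln L = \<theta>\<^sub>1 / p * ln L - \<theta>\<^sub>2 / q * ln L"
    by (simp add: \<delta>_def algebra_simps)
  ultimately have "\<delta> * ln L \<le> B" unfolding B_def by simp
  with lnL show False by simp
qed

end
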